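(* In $\mathbb{L}_2$, let $u=1+i$ and $v=1+j$. Then $\mathbb{L}_2\cong\mathbb{F}_2[u,v]/(u^2,v^2)$, the zero-divisor graph satisfies $G_2\cong F_3$, and the adjacency matrix $A_2=A(G_2)$ has characteristic polynomial $$\chi_{A_2}(\lambda)=(\lambda-3)(\lambda+2)(\lambda-1)^2(\lambda+1)^3.$$
   Context: For $n\ge2$, $\mathbb{L}_n=\{a+bi+cj+dk: a,b,c,d\in\mathbb{Z}/n\mathbb{Z}\}$ is the ring of Lipschitz quaternions modulo $n$, with the usual relations $i^2=j^2=k^2=-1$, $ij=k=-ji$, $jk=i=-kj$, $ki=j=-ik$ taken modulo $n$. A nonzero element $x$ of a ring is a zero divisor if $xy=0$ or $yx=0$ for some nonzero $y$. $G_n=\Gamma(\mathbb{L}_n)$ is the simple undirected graph whose vertices are the nonzero zero divisors of $\mathbb{L}_n$, distinct $x,y$ being adjacent iff $xy=0$ or $yx=0$; $A(G_n)$ is its adjacency matrix. $\mathbb{F}_2[u,v]/(u^2,v^2)$ is the quotient of the commutative polynomial ring in two variables, the isomorphism matching the variables with the elements $u,v$. $F_3$ is the friendship graph on $7$ vertices: three triangles sharing exactly one common vertex. $\chi_X(\lambda)=\det(\lambda I-X)$. *)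

theory Defs
  imports
    "HOL-Algebra.QuotRing"
    "HOL-Number_Theory.Residues"
    "HOL-Library.Poly_Mapping"
    "HOL-Library.Product_Plus"
    "HOL-Library.Z2"
    "Jordan_Normal_Form.Char_Poly"
    "Graph_Theory.Graph_Theory"
begin

text \<open>\<open>Quat a b c d\<close> stands for \<open>a + b i + c j + d k\<close>.\<close>

datatype 'a quat = Quat 'a 'a 'a 'a

fun quat_add :: "('a, 'b) ring_scheme \<Rightarrow> 'a quat \<Rightarrow> 'a quat \<Rightarrow> 'a quat" where
  "quat_add R (Quat a b c d) (Quat a' b' c' d') =
     Quat (a \<oplus>\<^bsub>R\<^esub> a') (b \<oplus>\<^bsub>R\<^esub> b') (c \<oplus>\<^bsub>R\<^esub> c') (d \<oplus>\<^bsub>R\<^esub> d')"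

text \<open>The bilinear extension of \<open>i\<^sup>2 = j\<^sup>2 = k\<^sup>2 = -1\<close>, \<open>ij = k = -ji\<close>, \<open>jk = i = -kj\<close>,
  \<open>ki = j = -ik\<close>.\<close>

fun quat_mult :: "('a, 'b) ring_scheme \<Rightarrow> 'a quat \<Rightarrow> 'a quat \<Rightarrow> 'a quat" where
  "quat_mult R (Quat a b c d) (Quat a' b' c' d') = Quat
     (a \<otimes>\<^bsub>R\<^esub> a' \<ominus>\<^bsub>R\<^esub> b \<otimes>\<^bsub>R\<^esub> b' \<ominus>\<^bsub>R\<^esub> c \<otimes>\<^bsub>R\<^esub> c' \<ominus>\<^bsub>R\<^esub> d \<otimes>\<^bsub>R\<^esub> d')
     (a \<otimes>\<^bsub>R\<^esub> b' \<oplus>\<^bsub>R\<^esub> b \<otimes>\<^bsub>R\<^esub> a' \<oplus>\<^bsub>R\<^esub> c \<otimes>\<^bsub>R\<^esub> d' \<ominus>\<^bsub>R\<^esub> d \<otimes>\<^bsub>R\<^esub> c')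
     (a \<otimes>\<^bsub>R\<^esub> c' \<ominus>\<^bsub>R\<^esub> b \<otimes>\<^bsub>R\<^esub> d' \<oplus>\<^bsub>R\<^esub> c \<otimes>\<^bsub>R\<^esub> a' \<oplus>\<^bsub>R\<^esub> d \<otimes>\<^bsub>R\<^esub> b')
     (a \<otimes>\<^bsub>R\<^esub> d' \<oplus>\<^bsub>R\<^esub> b \<otimes>\<^bsub>R\<^esub> c' \<ominus>\<^bsub>R\<^esub> c \<otimes>\<^bsub>R\<^esub> b' \<oplus>\<^bsub>R\<^esub> d \<otimes>\<^bsub>R\<^esub> a')"

definition quaternion_ring :: "('a, 'b) ring_scheme \<Rightarrow> 'a quat ring" where
  "quaternion_ring R =
     \<lparr>carrier = {Quat a b c d | a b c d.
        a \<in> carrier R \<and> b \<in> carrier R \<and> c \<in> carrier R \<and> d \<in> carrier R},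
      monoid.mult = quat_mult R,
      one = Quat \<one>\<^bsub>R\<^esub> \<zero>\<^bsub>R\<^esub> \<zero>\<^bsub>R\<^esub> \<zero>\<^bsub>R\<^esub>,
      zero = Quat \<zero>\<^bsub>R\<^esub> \<zero>\<^bsub>R\<^esub> \<zero>\<^bsub>R\<^esub> \<zero>\<^bsub>R\<^esub>,
      add = quat_add R\<rparr>"

definition quat_i :: "('a, 'b) ring_scheme \<Rightarrow> 'a quat" where
  "quat_i R = Quat \<zero>\<^bsub>R\<^esub> \<one>\<^bsub>R\<^esub> \<zero>\<^bsub>R\<^esub> \<zero>\<^bsub>R\<^esub>"

definition quat_j :: "('a, 'b) ring_scheme \<Rightarrow> 'a quat" where
  "quat_j R = Quat \<zero>\<^bsub>R\<^esub> \<zero>\<^bsub>R\<^esub> \<one>\<^bsub>R\<^esub> \<zero>\<^bsub>R\<^esub>"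

lemma (in cring) quaternion_ring_is_ring: "ring (quaternion_ring R)"
proof (rule ringI)
  let ?Q = "quaternion_ring R"
  note distribs = minus_eq l_distr r_distr l_minus r_minus minus_add minus_minus
  have mem: "x \<in> carrier ?Q \<longleftrightarrow> (\<exists>a b c d. x = Quat a b c d \<and> a \<in> carrier R \<and>
      b \<in> carrier R \<and> c \<in> carrier R \<and> d \<in> carrier R)" for x
    by (auto simp: quaternion_ring_def)
  have ops: "x \<otimes>\<^bsub>?Q\<^esub> y = quat_mult R x y" "x \<oplus>\<^bsub>?Q\<^esub> y = quat_add R x y"
      "\<one>\<^bsub>?Q\<^esub> = Quat \<one> \<zero> \<zero> \<zero>" "\<zero>\<^bsub>?Q\<^esub> = Quat \<zero> \<zero> \<zero> \<zero>" for x y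
    by (auto simp: quaternion_ring_def)
  show "abelian_group ?Q"
  proof (rule abelian_groupI)
    fix x assume "x \<in> carrier ?Q"
    then obtain a b c d where x: "x = Quat a b c d"
      and *: "a \<in> carrier R" "b \<in> carrier R" "c \<in> carrier R" "d \<in> carrier R"
      by (auto simp: mem)
    show "\<exists>y\<in>carrier ?Q. y \<oplus>\<^bsub>?Q\<^esub> x = \<zero>\<^bsub>?Q\<^esub>"
      by (rule bexI[of _ "Quat (\<ominus> a) (\<ominus> b) (\<ominus> c) (\<ominus> d)"])
        (use * in \<open>auto simp: mem ops x l_neg\<close>)
  qed (auto simp: mem ops a_ac)
  show "monoid ?Q"
    by (rule monoidI) (auto simp: mem ops distribs m_assoc a_ac)
  fix x y z assume "x \<in> carrier ?Q" "y \<in> carrier ?Q" "z \<in> carrier ?Q"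
  then show "(x \<oplus>\<^bsub>?Q\<^esub> y) \<otimes>\<^bsub>?Q\<^esub> z = x \<otimes>\<^bsub>?Q\<^esub> z \<oplus>\<^bsub>?Q\<^esub> y \<otimes>\<^bsub>?Q\<^esub> z"
    and "z \<otimes>\<^bsub>?Q\<^esub> (x \<oplus>\<^bsub>?Q\<^esub> y) = z \<otimes>\<^bsub>?Q\<^esub> x \<oplus>\<^bsub>?Q\<^esub> z \<otimes>\<^bsub>?Q\<^esub> y"
    by (auto simp: mem ops distribs a_ac)
qed

definition lipschitz_ring :: "nat \<Rightarrow> int quat ring" where
  "lipschitz_ring n = quaternion_ring (residue_ring (int n))"

definition zero_divisors :: "('a, 'b) ring_scheme \<Rightarrow> 'a set" where
  "zero_divisors R = {x \<in> carrier R - {\<zero>\<^bsub>R\<^esub>}.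
     \<exists>y \<in> carrier R - {\<zero>\<^bsub>R\<^esub>}. x \<otimes>\<^bsub>R\<^esub> y = \<zero>\<^bsub>R\<^esub> \<or> y \<otimes>\<^bsub>R\<^esub> x = \<zero>\<^bsub>R\<^esub>}"

text \<open>A simple undirected graph is encoded as a loop-free digraph with a symmetric set of arcs,
  each edge \<open>{x, y}\<close> giving the two arcs \<open>(x, y)\<close> and \<open>(y, x)\<close>.\<close>

definition zero_divisor_graph :: "('a, 'b) ring_scheme \<Rightarrow> 'a pair_pre_digraph" where
  "zero_divisor_graph R =
     \<lparr>pverts = zero_divisors R,
      parcs = {(x, y). x \<in> zero_divisors R \<and> y \<in> zero_divisors R \<and> x \<noteq> y \<and>
                 (x \<otimes>\<^bsub>R\<^esub> y = \<zero>\<^bsub>R\<^esub> \<or> y \<otimes>\<^bsub>R\<^esub> x = \<zero>\<^bsub>R\<^esub>)}\<rparr>"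

text \<open>The \<open>k\<close> triangles are \<open>{0, 2t - 1, 2t}\<close> for \<open>1 \<le> t \<le> k\<close>, with common vertex \<open>0\<close>.\<close>

definition friendship_graph :: "nat \<Rightarrow> nat pair_pre_digraph" where
  "friendship_graph k =
     \<lparr>pverts = {0..2 * k},
      parcs = {(x, y). x \<noteq> y \<and> (\<exists>t\<in>{1..k}. {x, y} \<subseteq> {0, 2 * t - 1, 2 * t})}\<rparr>"

text \<open>The adjacency matrix with respect to the ordering of the vertices given by the list \<open>vs\<close>.\<close>

definition adjacency_mat :: "'a pair_pre_digraph \<Rightarrow> 'a list \<Rightarrow> real mat" where
  "adjacency_mat G vs = mat (length vs) (length vs)
     (\<lambda>(r, c). if (vs ! r, vs ! c) \<in> parcs G then 1 else 0)"

text \<open>\<open>\<F>\<^sub>2[u,v]\<close> as the monoid algebra of \<open>\<nat> \<times> \<nat>\<close> over the two-element field: the key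
  \<open>(p, q)\<close> is the monomial \<open>u\<^sup>p v\<^sup>q\<close>.\<close>

type_synonym F2_poly2 = "(nat \<times> nat) \<Rightarrow>\<^sub>0 bit"

definition F2_uv :: "F2_poly2 ring" where
  "F2_uv = \<lparr>carrier = UNIV, monoid.mult = (*), one = 1, zero = 0, add = (+)\<rparr>"

definition var_u :: F2_poly2 where "var_u = Poly_Mapping.single (1, 0) 1"

definition var_v :: F2_poly2 where "var_v = Poly_Mapping.single (0, 1) 1"

definition ideal_u2_v2 :: "F2_poly2 set" where
  "ideal_u2_v2 = Idl\<^bsub>F2_uv\<^esub> {var_u ^ 2, var_v ^ 2}"

end

theory Submission
  imports Defs
begin

text \<open>
  In characteristic \<open>2\<close> the signs in the multiplication table disappear, so \<open>i\<close> and \<open>j\<close> commute and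
  \<open>(1 + i)\<^sup>2 = 1 + i\<^sup>2 = 0\<close>, likewise \<open>(1 + j)\<^sup>2 = 0\<close>.  Sending \<open>i\<close> to \<open>1 + u\<close>, \<open>j\<close> to \<open>1 + v\<close>
  and hence \<open>k = ij\<close> to \<open>(1 + u)(1 + v)\<close> therefore respects products modulo \<open>(u\<^sup>2, v\<^sup>2)\<close>
  (\<open>quat_poly_mult\<close>).  It is bijective because a class modulo \<open>(u\<^sup>2, v\<^sup>2)\<close> is determined by the
  coefficients of \<open>1\<close>, \<open>u\<close>, \<open>v\<close> and \<open>uv\<close> (\<open>coset_eq_iff_coefficients\<close>), and those depend on
  \<open>a + bi + cj + dk\<close> through an invertible linear map over the two-element field.

  For the graph, every \<open>x = a + bi + cj + dk\<close> has \<open>x\<^sup>2 = a + b + c + d\<close>.  If this sum is odd, \<open>x\<close> is its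
  own inverse; if it is even, \<open>x\<close> annihilates itself.  So the zero divisors are the seven nonzero
  elements \<open>\<alpha>u + \<beta>v + \<gamma>uv\<close>, and
  \<open>(\<alpha>u + \<beta>v + \<gamma>uv)(\<alpha>'u + \<beta>'v + \<gamma>'uv) = (\<alpha>\<beta>' + \<beta>\<alpha>')uv\<close>.  This vanishes exactly when \<open>(\<alpha>, \<beta>)\<close> and
  \<open>(\<alpha>', \<beta>')\<close> are linearly dependent: the vertex \<open>uv = 1 + i + j + k\<close> is joined to all others, and each of the
  three nonzero values of \<open>(\<alpha>, \<beta>)\<close> gives a pair \<open>{x, x + uv}\<close> that closes a triangle with \<open>uv\<close>.

  The spectrum of the friendship graph is read off from an explicit orthogonal basis of
  eigenvectors.  As functions on the vertices these do not refer to an ordering, so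
  \<open>char_poly_adjacency_mat_orthogonal_eigenvectors\<close> gives the characteristic polynomial for every
  enumeration of the vertices at once.
\<close>

section \<open>The ideal \<open>(u\<^sup>2, v\<^sup>2)\<close>\<close>

lemma cring_F2_uv: "cring F2_uv"
  unfolding F2_uv_def
  by (rule cringI, rule abelian_groupI, simp_all add: algebra_simps)
    (auto intro!: exI[of _ "- x" for x] comm_monoidI simp: algebra_simps)

lemma double_F2_poly2: "f + f = (0 :: F2_poly2)"
proof (rule poly_mapping_eqI)
  have "x + x = 0" for x :: bit by (cases x) simp_all
  then show "Poly_Mapping.lookup (f + f) k = Poly_Mapping.lookup 0 k" for k
    by (simp only: lookup_add lookup_zero)
qed

lemma two_F2_poly2: "(2 :: F2_poly2) = 0"
  using double_F2_poly2[of 1] by simp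

lemma minus_F2_poly2: "- f = (f :: F2_poly2)"
  using double_F2_poly2[of f] by (metis minus_unique)

lemma var_u_squared: "var_u ^ 2 = Poly_Mapping.single (2, 0) 1"
  and var_v_squared: "var_v ^ 2 = Poly_Mapping.single (0, 2) 1"
  by (simp_all add: var_u_def var_v_def power2_eq_square mult_single numeral_2_eq_2)

lemma poly_mapping_sum_monomials:
  "f = (\<Sum>k\<in>Poly_Mapping.keys f. Poly_Mapping.single k (Poly_Mapping.lookup f k))"
  by (rule poly_mapping_eqI)
    (simp add: lookup_sum lookup_single when_def in_keys_iff)

lemma F2_uv_simps [simp]:
  "carrier F2_uv = UNIV" "monoid.mult F2_uv = (*)" "one F2_uv = 1" "zero F2_uv = 0"
  "add F2_uv = (+)"
  by (simp_all add: F2_uv_def)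

interpretation F2: cring F2_uv
  by (rule cring_F2_uv)

lemma ideal_ideal_u2_v2: "ideal ideal_u2_v2 F2_uv"
  unfolding ideal_u2_v2_def by (rule F2.genideal_ideal) simp

lemmas ideal_u2_v2_add_closed =
    additive_subgroup.a_closed[OF ideal.axioms(1)[OF ideal_ideal_u2_v2], simplified]
  and ideal_u2_v2_mult_closed = ideal.I_l_closed[OF ideal_ideal_u2_v2, simplified]
  and ideal_u2_v2_zero =
    additive_subgroup.zero_closed[OF ideal.axioms(1)[OF ideal_ideal_u2_v2], simplified]

lemma squares_in_ideal: "var_u ^ 2 \<in> ideal_u2_v2" "var_v ^ 2 \<in> ideal_u2_v2"
  using F2.genideal_self[of "{var_u ^ 2, var_v ^ 2}"] unfolding ideal_u2_v2_def by auto

text \<open>Being generated by monomials, the ideal consists of the polynomials all of whose monomials are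
  divisible by a generator.  The right-hand side is an ideal containing both generators, and each
  of its elements is a sum of multiples of them.\<close>

lemma ideal_u2_v2_iff_keys:
  "f \<in> ideal_u2_v2 \<longleftrightarrow> Poly_Mapping.keys f \<subseteq> {(p, q). p \<ge> 2 \<or> q \<ge> 2}"
proof
  let ?J = "{f :: F2_poly2. Poly_Mapping.keys f \<subseteq> {(p, q). p \<ge> 2 \<or> q \<ge> 2}}"
  have "ideal ?J F2_uv"
  proof (rule idealI)
    show "ring F2_uv" by (rule F2.ring_axioms)
    have inv: "inv\<^bsub>add_monoid F2_uv\<^esub> f = f" for f
      by (rule group.inv_equality[OF F2.a_group]) (simp_all add: double_F2_poly2)
    show "subgroup ?J (add_monoid F2_uv)"
    proof (rule subgroup.intro)
      fix f g assume "f \<in> ?J" "g \<in> ?J"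
      then show "f \<otimes>\<^bsub>add_monoid F2_uv\<^esub> g \<in> ?J"
        using Poly_Mapping.keys_add[of f g] by auto
    next
      fix f assume "f \<in> ?J"
      then show "inv\<^bsub>add_monoid F2_uv\<^esub> f \<in> ?J" by (simp only: inv)
    qed auto
    fix f g assume f: "f \<in> ?J"
    then have "Poly_Mapping.keys (f * g) \<subseteq> {(p, q). p \<ge> 2 \<or> q \<ge> 2}"
      using keys_mult[of f g] by fastforce
    then show "f \<otimes>\<^bsub>F2_uv\<^esub> g \<in> ?J" "g \<otimes>\<^bsub>F2_uv\<^esub> f \<in> ?J"
      by (simp_all add: mult.commute)
  qed
  then have "ideal_u2_v2 \<subseteq> ?J"
    unfolding ideal_u2_v2_def
    by (rule F2.genideal_minimal) (simp add: var_u_squared var_v_squared)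
  then show "f \<in> ideal_u2_v2 \<Longrightarrow> Poly_Mapping.keys f \<subseteq> {(p, q). p \<ge> 2 \<or> q \<ge> 2}"
    by auto
next
  assume *: "Poly_Mapping.keys f \<subseteq> {(p, q). p \<ge> 2 \<or> q \<ge> 2}"
  have mono: "Poly_Mapping.single k c \<in> ideal_u2_v2" if "k \<in> Poly_Mapping.keys f" for k c
  proof -
    obtain p q where k: "k = (p, q)" by force
    with * that consider "p \<ge> 2" | "q \<ge> 2" by auto
    then show ?thesis
    proof cases
      case 1
      then have "Poly_Mapping.single k c = Poly_Mapping.single (p - 2, q) c * var_u ^ 2"
        by (simp only: k var_u_squared mult_single add_Pair le_add_diff_inverse2 add_0_right
            mult_1_right)
      then show ?thesis using ideal_u2_v2_mult_closed squares_in_ideal by simp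
    next
      case 2
      then have "Poly_Mapping.single k c = Poly_Mapping.single (p, q - 2) c * var_v ^ 2"
        by (simp only: k var_v_squared mult_single add_Pair le_add_diff_inverse2 add_0_right
            mult_1_right)
      then show ?thesis using ideal_u2_v2_mult_closed squares_in_ideal by simp
    qed
  qed
  have "(\<Sum>k\<in>A. Poly_Mapping.single k (Poly_Mapping.lookup f k)) \<in> ideal_u2_v2"
    if "finite A" "A \<subseteq> Poly_Mapping.keys f" for A
    using that by induction (auto simp: mono ideal_u2_v2_add_closed ideal_u2_v2_zero)
  from this[of "Poly_Mapping.keys f"] show "f \<in> ideal_u2_v2"
    by (subst poly_mapping_sum_monomials) simp
qed

lemma coset_eq_iff_coefficients:
  "ideal_u2_v2 +>\<^bsub>F2_uv\<^esub> f = ideal_u2_v2 +>\<^bsub>F2_uv\<^esub> g \<longleftrightarrow>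
   (\<forall>p<2. \<forall>q<2. Poly_Mapping.lookup f (p, q) = Poly_Mapping.lookup g (p, q))"
proof -
  have "f \<ominus>\<^bsub>F2_uv\<^esub> g = f - g"
    using F2.minus_equality[of g g] double_F2_poly2[of g] minus_F2_poly2[of g]
    by (simp add: a_minus_def diff_conv_add_uminus del: add_uminus_conv_diff)
  then have "ideal_u2_v2 +>\<^bsub>F2_uv\<^esub> f = ideal_u2_v2 +>\<^bsub>F2_uv\<^esub> g \<longleftrightarrow> f - g \<in> ideal_u2_v2"
    using F2.quotient_eq_iff_same_a_r_cos[OF ideal_ideal_u2_v2, of f g] by simp
  also have "\<dots> \<longleftrightarrow> (\<forall>p<2. \<forall>q<2. Poly_Mapping.lookup (f - g) (p, q) = 0)"
    by (auto simp: ideal_u2_v2_iff_keys in_keys_iff subset_iff simp del: bit_not_zero_iff)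
      (metis not_less)+
  finally show ?thesis
    by (simp add: lookup_minus del: minus_bit_def)
qed

section \<open>The isomorphism with the quaternions modulo 2\<close>

text \<open>Inverting \<open>u = 1 + i\<close> and \<open>v = 1 + j\<close> in characteristic \<open>2\<close> forces \<open>i \<mapsto> 1 + u\<close>, \<open>j \<mapsto> 1 + v\<close>.
  This lift to polynomials is additive, but multiplicative only modulo the ideal.\<close>

fun quat_poly :: "int quat \<Rightarrow> F2_poly2" where
  "quat_poly (Quat a b c d) = of_int a + of_int b * (1 + var_u) + of_int c * (1 + var_v)
     + of_int d * ((1 + var_u) * (1 + var_v))"

lemma lookup_quat_poly:
  "Poly_Mapping.lookup (quat_poly (Quat a b c d)) (0, 0) = of_int (a + b + c + d)"
  "Poly_Mapping.lookup (quat_poly (Quat a b c d)) (Suc 0, 0) = of_int (b + d)"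
  "Poly_Mapping.lookup (quat_poly (Quat a b c d)) (0, Suc 0) = of_int (c + d)"
  "Poly_Mapping.lookup (quat_poly (Quat a b c d)) (Suc 0, Suc 0) = of_int d"
proof -
  have const: "of_int n = Poly_Mapping.single (0 :: nat \<times> nat) (of_int n :: bit)" for n
    by (rule single_of_int[symmetric])
  have monomial: "of_int n * var_u = Poly_Mapping.single (1, 0) (of_int n)"
    "of_int n * var_v = Poly_Mapping.single (0, 1) (of_int n)"
    "of_int n * (var_u * var_v) = Poly_Mapping.single (1, 1) (of_int n)" for n
    unfolding const var_u_def var_v_def
    by (simp_all only: mult_single add_0 mult_1_right add_Pair add_0_right)
  have "quat_poly (Quat a b c d) = of_int (a + b + c + d) + of_int (b + d) * var_u
      + of_int (c + d) * var_v + of_int d * (var_u * var_v)"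
    by (simp add: algebra_simps)
  also have "\<dots> = Poly_Mapping.single 0 (of_int (a + b + c + d))
      + Poly_Mapping.single (1, 0) (of_int (b + d)) + Poly_Mapping.single (0, 1) (of_int (c + d))
      + Poly_Mapping.single (1, 1) (of_int d)"
    unfolding monomial unfolding const ..
  finally show "Poly_Mapping.lookup (quat_poly (Quat a b c d)) (0, 0) = of_int (a + b + c + d)"
    "Poly_Mapping.lookup (quat_poly (Quat a b c d)) (Suc 0, 0) = of_int (b + d)"
    "Poly_Mapping.lookup (quat_poly (Quat a b c d)) (0, Suc 0) = of_int (c + d)"
    "Poly_Mapping.lookup (quat_poly (Quat a b c d)) (Suc 0, Suc 0) = of_int d"
    by (simp_all add: lookup_add lookup_single when_def zero_prod_def)
qed

lemma residues_2: "residues 2"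
  by unfold_locales simp

lemmas residue_2_simps =
  residues.res_zero_eq[OF residues_2] residues.res_one_eq[OF residues_2]
  residues.res_add_eq[OF residues_2] residues.res_mult_eq[OF residues_2]
  residues.res_neg_eq[OF residues_2] residues.res_carrier_eq[OF residues_2]

lemma ring_lipschitz_2: "ring (lipschitz_ring 2)"
  using cring.quaternion_ring_is_ring[OF residues.cring[OF residues_2]]
  by (simp add: lipschitz_ring_def)

lemma carrier_lipschitz_2:
  "carrier (lipschitz_ring 2) =
     {Quat a b c d | a b c d. {a, b, c, d} \<subseteq> {0, 1}}"
proof -
  have "{0..2 - 1} = {0, 1 :: int}" by auto
  then show ?thesis
    by (auto simp: lipschitz_ring_def quaternion_ring_def residue_2_simps)
qed

lemma lipschitz_2_simps:
  "\<one>\<^bsub>lipschitz_ring 2\<^esub> = Quat 1 0 0 0"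
  "\<zero>\<^bsub>lipschitz_ring 2\<^esub> = Quat 0 0 0 0"
  "Quat a b c d \<oplus>\<^bsub>lipschitz_ring 2\<^esub> Quat a' b' c' d' =
     Quat ((a + a') mod 2) ((b + b') mod 2) ((c + c') mod 2) ((d + d') mod 2)"
  "Quat a b c d \<otimes>\<^bsub>lipschitz_ring 2\<^esub> Quat a' b' c' d' = Quat
     ((a * a' - b * b' - c * c' - d * d') mod 2) ((a * b' + b * a' + c * d' - d * c') mod 2)
     ((a * c' - b * d' + c * a' + d * b') mod 2) ((a * d' + b * c' - c * b' + d * a') mod 2)"
  by (simp_all add: lipschitz_ring_def quaternion_ring_def residue_2_simps a_minus_def mod_simps)

lemma of_int_mod_2_F2_poly2: "of_int (n mod 2) = (of_int n :: F2_poly2)"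
proof -
  have "of_int n = (of_int (2 * (n div 2) + n mod 2) :: F2_poly2)" by simp
  also have "\<dots> = of_int (n mod 2)"
    by (simp only: of_int_add of_int_mult of_int_numeral two_F2_poly2 mult_zero_left add_0)
  finally show ?thesis ..
qed

lemma quat_poly_add:
  "quat_poly (x \<oplus>\<^bsub>lipschitz_ring 2\<^esub> y) = quat_poly x + quat_poly y"
  by (cases x; cases y) (simp add: lipschitz_2_simps of_int_mod_2_F2_poly2 algebra_simps)

text \<open>The images \<open>i\<close>, \<open>j\<close> of the quaternion units satisfy \<open>i\<^sup>2 = 1 + u\<^sup>2\<close> and \<open>j\<^sup>2 = 1 + v\<^sup>2\<close>, where the
  relations of the quaternion ring, read modulo \<open>2\<close>, ask for \<open>1\<close>.  Expanding a product, the excess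
  is a combination of \<open>u\<^sup>2\<close> and \<open>v\<^sup>2\<close>.\<close>

lemma quat_poly_mult:
  "\<exists>f g. quat_poly x * quat_poly y =
     f * var_u ^ 2 + g * var_v ^ 2 + quat_poly (x \<otimes>\<^bsub>lipschitz_ring 2\<^esub> y)"
proof -
  obtain a b c d where x: "x = Quat a b c d" by (cases x)
  obtain a' b' c' d' where y: "y = Quat a' b' c' d'" by (cases y)
  define i j where "i = 1 + var_u" and "j = 1 + var_v"
  have sq: "i * i = 1 + var_u ^ 2" "j * j = 1 + var_v ^ 2"
    by (simp_all add: i_def j_def power2_eq_square algebra_simps double_F2_poly2
        flip: add.assoc)
  have key: "(a + b * i + c * j + d * (i * j)) * (a' + b' * i + c' * j + d' * (i * j)) =
      (b * b' + d * d' * (1 + t) + (b * d' + d * b') * j) * s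
    + (c * c' + d * d' + (c * d' + d * c') * i) * t
    + ((a * a' - b * b' - c * c' - d * d') + (a * b' + b * a' + c * d' - d * c') * i
      + (a * c' - b * d' + c * a' + d * b') * j
      + (a * d' + b * c' - c * b' + d * a') * (i * j))" (is "?l = ?r")
    if "i * i = 1 + s" "j * j = 1 + t" for a b c d a' b' c' d' i j s t :: F2_poly2
  proof -
    have st: "s = i * i - 1" "t = j * j - 1" using that by simp_all
    \<comment> \<open>The terms whose sign in the quaternion product is negative appear doubled in the
      difference of the two sides.\<close>
    have "?l = ?r + 2 * (b * b' + c * c' + d * d' + d * c' * i + b * d' * j + c * b' * (i * j))"
      unfolding st by (simp add: algebra_simps)
    then show ?thesis by (simp only: two_F2_poly2 mult_zero_left add_0_right)
  qed
  show ?thesis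
    unfolding x y lipschitz_2_simps quat_poly.simps of_int_mod_2_F2_poly2 of_int_add of_int_diff
      of_int_mult i_def[symmetric] j_def[symmetric]
    by (intro exI, rule key[OF sq])
qed

lemma of_int_bit_eq_iff:
  "a \<in> {0, 1} \<Longrightarrow> a' \<in> {0, 1} \<Longrightarrow> (of_int a :: bit) = of_int a' \<longleftrightarrow> a = a'"
  by auto

lemma quat_poly_coset_ring_iso:
  "(\<lambda>x. ideal_u2_v2 +>\<^bsub>F2_uv\<^esub> quat_poly x) \<in> ring_iso (lipschitz_ring 2) (F2_uv Quot ideal_u2_v2)"
  (is "?\<phi> \<in> _")
proof -
  let ?L = "lipschitz_ring 2"
  have all2: "(\<forall>p<2. P p) \<longleftrightarrow> P 0 \<and> P (Suc 0)" for P
    by (auto simp: numeral_2_eq_2 less_Suc_eq)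
  have carr: "carrier (F2_uv Quot ideal_u2_v2) = range (\<lambda>f. ideal_u2_v2 +>\<^bsub>F2_uv\<^esub> f)"
    by (auto simp: FactRing_def A_RCOSETS_def RCOSETS_def a_r_coset_def)
  have "?\<phi> \<in> Ring.ring_hom ?L (F2_uv Quot ideal_u2_v2)"
  proof (rule ring_hom_memI)
    fix x y
    show "?\<phi> x \<in> carrier (F2_uv Quot ideal_u2_v2)" by (simp add: carr)
    show "?\<phi> (x \<oplus>\<^bsub>?L\<^esub> y) = ?\<phi> x \<oplus>\<^bsub>F2_uv Quot ideal_u2_v2\<^esub> ?\<phi> y"
      by (simp add: FactRing_def ideal.a_rcos_sum[OF ideal_ideal_u2_v2] quat_poly_add)
    obtain f g where *: "quat_poly x * quat_poly y =
        f * var_u ^ 2 + g * var_v ^ 2 + quat_poly (x \<otimes>\<^bsub>?L\<^esub> y)"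
      using quat_poly_mult by blast
    have "f * var_u ^ 2 + g * var_v ^ 2 \<in> ideal_u2_v2"
      by (intro ideal_u2_v2_add_closed ideal_u2_v2_mult_closed squares_in_ideal)
    then have "quat_poly x * quat_poly y \<in> ideal_u2_v2 +>\<^bsub>F2_uv\<^esub> quat_poly (x \<otimes>\<^bsub>?L\<^esub> y)"
      by (auto simp: a_r_coset_def r_coset_def * F2_uv_def)
    then have "?\<phi> (x \<otimes>\<^bsub>?L\<^esub> y) = ideal_u2_v2 +>\<^bsub>F2_uv\<^esub> (quat_poly x * quat_poly y)"
      using F2.a_repr_independence[OF _ _ additive_subgroup.a_subgroup[OF ideal.axioms(1)],
          OF _ _ ideal_ideal_u2_v2] by simp
    then show "?\<phi> (x \<otimes>\<^bsub>?L\<^esub> y) = ?\<phi> x \<otimes>\<^bsub>F2_uv Quot ideal_u2_v2\<^esub> ?\<phi> y"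
      by (simp add: FactRing_def ideal.rcoset_mult_add[OF ideal_ideal_u2_v2])
  next
    show "?\<phi> \<one>\<^bsub>?L\<^esub> = \<one>\<^bsub>F2_uv Quot ideal_u2_v2\<^esub>"
      by (simp add: FactRing_def lipschitz_2_simps)
  qed
  moreover have "inj_on ?\<phi> (carrier ?L)"
  proof (rule inj_onI)
    fix x y assume x: "x \<in> carrier ?L" and y: "y \<in> carrier ?L" and eq: "?\<phi> x = ?\<phi> y"
    obtain a b c d where xq: "x = Quat a b c d" "{a, b, c, d} \<subseteq> {0, 1}"
      using x unfolding carrier_lipschitz_2 by blast
    obtain a' b' c' d' where yq: "y = Quat a' b' c' d'" "{a', b', c', d'} \<subseteq> {0, 1}"
      using y unfolding carrier_lipschitz_2 by blast
    have coeffs: "of_int (a + b + c + d) = (of_int (a' + b' + c' + d') :: bit)"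
      "of_int (b + d) = (of_int (b' + d') :: bit)" "of_int (c + d) = (of_int (c' + d') :: bit)"
      "of_int d = (of_int d' :: bit)"
      using eq unfolding coset_eq_iff_coefficients all2 xq(1) yq(1) lookup_quat_poly by blast+
    then have "of_int b = (of_int b' :: bit)" "of_int c = (of_int c' :: bit)"
      unfolding of_int_add by (metis add_right_cancel)+
    moreover from this coeffs have "of_int a = (of_int a' :: bit)"
      unfolding of_int_add by (metis add_right_cancel)
    moreover note coeffs(4)
    ultimately show "x = y" using xq yq by (simp add: of_int_bit_eq_iff)
  qed
  moreover have "ideal_u2_v2 +>\<^bsub>F2_uv\<^esub> f \<in> ?\<phi> ` carrier ?L" for f
  proof -
    \<comment> \<open>The coefficients \<open>a + b + c + d\<close>, \<open>b + d\<close>, \<open>c + d\<close>, \<open>d\<close> of \<open>quat_poly\<close> are solved for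
      \<open>d\<close>, \<open>c\<close>, \<open>b\<close>, \<open>a\<close> in turn.\<close>
    let ?z = "\<lambda>z :: bit. of_bit z :: int"
    define d where "d = Poly_Mapping.lookup f (1, 1)"
    define c where "c = Poly_Mapping.lookup f (0, 1) + d"
    define b where "b = Poly_Mapping.lookup f (1, 0) + d"
    define a where "a = Poly_Mapping.lookup f (0, 0) + b + c + d"
    have z: "of_int (?z x) = x" "x = 0 \<or> x = 1" for x :: bit by (cases x; simp)+
    have cancel: "x + y + y = x" "x + p + q + r + p + q + r = x" for x y p q r :: bit
      by (cases x; cases y; simp) (cases x; cases p; cases q; cases r; simp)
    have sums: "a + b + c + d = Poly_Mapping.lookup f (0, 0)"
      "b + d = Poly_Mapping.lookup f (Suc 0, 0)" "c + d = Poly_Mapping.lookup f (0, Suc 0)"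
      by (simp_all only: a_def b_def c_def d_def cancel One_nat_def)
    have "Quat (?z a) (?z b) (?z c) (?z d) \<in> carrier ?L"
      by (simp add: carrier_lipschitz_2 z)
    moreover have "ideal_u2_v2 +>\<^bsub>F2_uv\<^esub> f = ?\<phi> (Quat (?z a) (?z b) (?z c) (?z d))"
      unfolding coset_eq_iff_coefficients all2 lookup_quat_poly of_int_add z(1) sums(1-3)
      by (simp add: d_def)
    ultimately show ?thesis by blast
  qed
  ultimately show ?thesis
    by (auto simp: ring_iso_def bij_betw_def carr)
qed

section \<open>The zero-divisor graph\<close>

text \<open>The mixed terms of a square cancel in pairs or come twice, and \<open>a\<^sup>2 - b\<^sup>2 - c\<^sup>2 - d\<^sup>2\<close> is congruent
  to \<open>a + b + c + d\<close> modulo \<open>2\<close>.\<close>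

lemma square_lipschitz_2:
  "Quat a b c d \<otimes>\<^bsub>lipschitz_ring 2\<^esub> Quat a b c d = Quat ((a + b + c + d) mod 2) 0 0 0"
proof -
  have "(a * a - b * b - c * c - d * d) mod 2 = (a + b + c + d) mod 2"
    by (simp add: mod_eq_dvd_iff)
  moreover have "even (a * b + b * a + c * d - d * c)" "even (a * c - b * d + c * a + d * b)"
    "even (a * d + b * c - c * b + d * a)" by auto
  ultimately show ?thesis by (simp add: lipschitz_2_simps)
qed

text \<open>By the formula for squares, an element with odd coordinate sum is a unit, being its own inverse,
  and a nonzero element with even coordinate sum is a zero divisor, its square being zero.\<close>

lemma zero_divisors_lipschitz_2_iff:
  "x \<in> zero_divisors (lipschitz_ring 2) \<longleftrightarrow>
    (\<exists>a b c d. x = Quat a b c d \<and> {a, b, c, d} \<subseteq> {0, 1} \<and> x \<noteq> Quat 0 0 0 0 \<and> even (a + b + c + d))"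
proof -
  interpret L: ring "lipschitz_ring 2" by (rule ring_lipschitz_2)
  have even: "even (a + b + c + d)"
    if x: "x = Quat a b c d" and zd: "x \<in> zero_divisors (lipschitz_ring 2)" for a b c d
  proof (rule ccontr)
    assume "odd (a + b + c + d)"
    then have sq: "x \<otimes>\<^bsub>lipschitz_ring 2\<^esub> x = \<one>\<^bsub>lipschitz_ring 2\<^esub>"
      by (simp add: x square_lipschitz_2 lipschitz_2_simps(1) odd_iff_mod_2_eq_one del: even_add)
    from zd obtain y where y: "x \<in> carrier (lipschitz_ring 2)" "y \<in> carrier (lipschitz_ring 2)"
      "y \<noteq> \<zero>\<^bsub>lipschitz_ring 2\<^esub>"
      "x \<otimes>\<^bsub>lipschitz_ring 2\<^esub> y = \<zero>\<^bsub>lipschitz_ring 2\<^esub> \<or> y \<otimes>\<^bsub>lipschitz_ring 2\<^esub> x = \<zero>\<^bsub>lipschitz_ring 2\<^esub>"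
      by (auto simp: zero_divisors_def)
    then show False
      by (metis L.l_null L.r_null L.l_one L.r_one L.m_assoc sq)
  qed
  show ?thesis
  proof
    assume zd: "x \<in> zero_divisors (lipschitz_ring 2)"
    then have "x \<in> carrier (lipschitz_ring 2)" "x \<noteq> Quat 0 0 0 0"
      by (auto simp: zero_divisors_def lipschitz_2_simps)
    with even[OF _ zd] show "\<exists>a b c d. x = Quat a b c d \<and> {a, b, c, d} \<subseteq> {0, 1} \<and>
        x \<noteq> Quat 0 0 0 0 \<and> even (a + b + c + d)"
      unfolding carrier_lipschitz_2 by blast
  next
    assume "\<exists>a b c d. x = Quat a b c d \<and> {a, b, c, d} \<subseteq> {0, 1} \<and> x \<noteq> Quat 0 0 0 0 \<and>
      even (a + b + c + d)"
    then have "x \<in> carrier (lipschitz_ring 2) - {\<zero>\<^bsub>lipschitz_ring 2\<^esub>}"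
      "x \<otimes>\<^bsub>lipschitz_ring 2\<^esub> x = \<zero>\<^bsub>lipschitz_ring 2\<^esub>"
      by (auto simp: carrier_lipschitz_2 lipschitz_2_simps(2) square_lipschitz_2
          even_iff_mod_2_eq_zero simp del: even_add)
    then show "x \<in> zero_divisors (lipschitz_ring 2)"
      by (auto simp: zero_divisors_def)
  qed
qed

lemma zero_divisors_lipschitz_2:
  "zero_divisors (lipschitz_ring 2) =
    {Quat 1 1 1 1, Quat 1 1 0 0, Quat 0 0 1 1, Quat 1 0 1 0, Quat 0 1 0 1, Quat 1 0 0 1, Quat 0 1 1 0}"
proof (intro equalityI subsetI)
  fix x assume "x \<in> zero_divisors (lipschitz_ring 2)"
  then obtain a b c d :: int where x: "x = Quat a b c d" and sum: "even (a + b + c + d)"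
    and ne: "x \<noteq> Quat 0 0 0 0" and mem: "{a, b, c, d} \<subseteq> {0, 1}"
    unfolding zero_divisors_lipschitz_2_iff by blast
  from mem have "a = 0 \<or> a = 1" "b = 0 \<or> b = 1" "c = 0 \<or> c = 1" "d = 0 \<or> d = 1" by auto
  then show "x \<in> {Quat 1 1 1 1, Quat 1 1 0 0, Quat 0 0 1 1, Quat 1 0 1 0, Quat 0 1 0 1,
      Quat 1 0 0 1, Quat 0 1 1 0}"
    using sum ne unfolding x by (elim disjE) simp_all
qed (auto simp: zero_divisors_lipschitz_2_iff)

text \<open>The vertex \<open>uv = 1 + i + j + k\<close> becomes the centre \<open>0\<close>.  Any other zero divisor has exactly two
  coordinates equal to \<open>1\<close>, so exactly one of \<open>b\<close>, \<open>c\<close>, \<open>d\<close> agrees with \<open>a\<close>; this choice is unchanged by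
  adding \<open>uv\<close> and selects the triangle, and \<open>a\<close> selects the vertex in it.\<close>

fun triangle_label :: "int quat \<Rightarrow> nat" where
  "triangle_label (Quat a b c d) =
     (if a = b \<and> b = c then 0
      else if a = b then 2 - nat a else if a = c then 4 - nat a else 6 - nat a)"

lemma bij_betw_triangle_label:
  "bij_betw triangle_label (pverts (zero_divisor_graph (lipschitz_ring 2)))
     (pverts (friendship_graph 3))"
proof -
  have "{0..2 * 3} = {0, 1, 2, 3, 4, 5, 6 :: nat}" by auto
  then show ?thesis
    by (auto simp: bij_betw_def zero_divisor_graph_def friendship_graph_def zero_divisors_lipschitz_2)
qed

lemma friendship_graph_3_arc_iff:
  "(x, y) \<in> parcs (friendship_graph 3) \<longleftrightarrow>
    x \<noteq> y \<and> ({x, y} \<subseteq> {0, 1, 2} \<or> {x, y} \<subseteq> {0, 3, 4} \<or> {x, y} \<subseteq> {0, 5, 6})"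
proof -
  have "{1..3} = {1, 2, 3 :: nat}" by auto
  then show ?thesis by (simp add: friendship_graph_def)
qed

lemma triangle_label_arc_iff:
  assumes "x \<in> pverts (zero_divisor_graph (lipschitz_ring 2))"
    and "y \<in> pverts (zero_divisor_graph (lipschitz_ring 2))"
  shows "(x, y) \<in> parcs (zero_divisor_graph (lipschitz_ring 2)) \<longleftrightarrow>
    (triangle_label x, triangle_label y) \<in> parcs (friendship_graph 3)"
proof -
  let ?L = "lipschitz_ring 2"
  have "(x, y) \<in> parcs (zero_divisor_graph ?L) \<longleftrightarrow>
      x \<noteq> y \<and> (x \<otimes>\<^bsub>?L\<^esub> y = Quat 0 0 0 0 \<or> y \<otimes>\<^bsub>?L\<^esub> x = Quat 0 0 0 0)"
    using assms by (simp add: zero_divisor_graph_def lipschitz_2_simps(2))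
  moreover have "\<dots> \<longleftrightarrow> (triangle_label x, triangle_label y) \<in> parcs (friendship_graph 3)"
    using assms
    unfolding zero_divisor_graph_def pair_pre_digraph.simps zero_divisors_lipschitz_2
      friendship_graph_3_arc_iff insert_iff empty_iff simp_thms
    by (elim disjE) (simp_all add: lipschitz_2_simps(4))
  ultimately show ?thesis by blast
qed

lemma digraph_iso_with_projI:
  assumes "pair_wf_digraph G" "pair_wf_digraph H"
    and bij: "bij_betw f (pverts G) (pverts H)"
    and arcs: "\<And>x y. x \<in> pverts G \<Longrightarrow> y \<in> pverts G \<Longrightarrow>
      (x, y) \<in> parcs G \<longleftrightarrow> (f x, f y) \<in> parcs H"
  shows "digraph_iso (with_proj G) (with_proj H)"
proof -
  interpret G: pair_wf_digraph G by fact
  interpret H: pair_wf_digraph H by fact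
  have "parcs G \<subseteq> pverts G \<times> pverts G"
    using G.wellformed' by auto
  moreover have "inj_on (map_prod f f) (pverts G \<times> pverts G)"
    using bij by (auto simp: bij_betw_def intro: map_prod_inj_on)
  ultimately have inj: "inj_on (map_prod f f) (parcs G)"
    by (rule inj_on_subset[rotated])
  have img: "map_prod f f ` parcs G = parcs H"
  proof (intro equalityI subsetI)
    fix e assume "e \<in> parcs H"
    moreover obtain x' y' where e: "e = (x', y')" by force
    ultimately obtain x y where "x \<in> pverts G" "y \<in> pverts G" "x' = f x" "y' = f y"
      using H.wellformed' bij by (metis bij_betw_imp_surj_on imageE)
    with e \<open>e \<in> parcs H\<close> arcs show "e \<in> map_prod f f ` parcs G" by force
  next
    fix e assume "e \<in> map_prod f f ` parcs G"
    then obtain x y where "(x, y) \<in> parcs G" "e = (f x, f y)" by auto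
    then show "e \<in> parcs H" using arcs G.wellformed' by metis
  qed
  let ?h = "\<lparr>iso_verts = f, iso_arcs = map_prod f f, iso_head = snd, iso_tail = fst\<rparr>"
  have "pre_digraph.digraph_isomorphism (with_proj G) ?h"
    using bij inj by (auto simp: pre_digraph.digraph_isomorphism_def wf_digraph_wp_iff assms
        bij_betw_def)
  moreover have "with_proj H = app_iso ?h (with_proj G)"
    using bij img by (simp add: with_proj_def app_iso_def bij_betw_def)
  ultimately show ?thesis
    unfolding digraph_iso_def by blast
qed

section \<open>The characteristic polynomial\<close>

text \<open>With the eigenvectors \<open>E c\<close> as the columns of a matrix \<open>P\<close>, orthogonality says that the
  transpose of \<open>P\<close>, its rows divided by the squared norms, is the inverse of \<open>P\<close>.  Conjugation
  by \<open>P\<close> then turns the adjacency matrix into the diagonal matrix of the eigenvalues.  Listing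
  the vertices differently only permutes the rows of \<open>P\<close>.\<close>

lemma char_poly_adjacency_mat_orthogonal_eigenvectors:
  fixes E :: "nat \<Rightarrow> 'a \<Rightarrow> real"
  assumes vs: "distinct vs" "set vs = pverts G" "length vs = length evs"
    and eigen: "\<And>c x. c < length evs \<Longrightarrow> x \<in> pverts G \<Longrightarrow>
      (\<Sum>y\<in>pverts G. of_bool ((x, y) \<in> parcs G) * E c y) = evs ! c * E c x"
    and orth: "\<And>c c'. c < length evs \<Longrightarrow> c' < length evs \<Longrightarrow> c \<noteq> c' \<Longrightarrow>
      (\<Sum>x\<in>pverts G. E c x * E c' x) = 0"
    and nonzero: "\<And>c. c < length evs \<Longrightarrow> (\<Sum>x\<in>pverts G. E c x * E c x) \<noteq> 0"
  shows "char_poly (adjacency_mat G vs) = (\<Prod>a\<leftarrow>evs. [:- a, 1:])"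
proof -
  define n where "n = length evs"
  define N where "N c = (\<Sum>x\<in>pverts G. E c x * E c x)" for c
  define A where "A = adjacency_mat G vs"
  define P where "P = mat n n (\<lambda>(r, c). E c (vs ! r))"
  define Q where "Q = mat n n (\<lambda>(c, r). E c (vs ! r) / N c)"
  define D where "D = mat n n (\<lambda>(r, c). if r = c then evs ! c else 0)"
  have carrier: "A \<in> carrier_mat n n" "P \<in> carrier_mat n n" "Q \<in> carrier_mat n n"
    "D \<in> carrier_mat n n"
    using vs by (auto simp: A_def P_def Q_def D_def adjacency_mat_def n_def)
  have sum_vs: "(\<Sum>k = 0..<n. f (vs ! k)) = (\<Sum>x\<in>pverts G. f x)" for f :: "'a \<Rightarrow> real"
    using sum.reindex_bij_betw[OF bij_betw_nth[OF vs(1) refl vs(2)[symmetric]], of f]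
    by (simp add: n_def vs(3) atLeast0LessThan)
  have QP: "Q * P = 1\<^sub>m n"
  proof (rule eq_matI)
    fix c c' assume "c < dim_row (1\<^sub>m n)" "c' < dim_col (1\<^sub>m n)"
    then have c: "c < n" "c' < n" by auto
    have "(Q * P) $$ (c, c') = (\<Sum>k = 0..<n. E c (vs ! k) / N c * E c' (vs ! k))"
      using c by (simp add: P_def Q_def scalar_prod_def)
    also have "\<dots> = (\<Sum>x\<in>pverts G. E c x / N c * E c' x)"
      by (rule sum_vs)
    also have "\<dots> = (\<Sum>x\<in>pverts G. E c x * E c' x) / N c"
      by (simp add: sum_divide_distrib)
    also have "\<dots> = 1\<^sub>m n $$ (c, c')"
      using c orth nonzero by (auto simp: N_def n_def)
    finally show "(Q * P) $$ (c, c') = 1\<^sub>m n $$ (c, c')" .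
  qed (use carrier in auto)
  then have PQ: "P * Q = 1\<^sub>m n"
    using carrier mat_mult_left_right_inverse by blast
  have "A * P = P * D"
  proof (rule eq_matI)
    fix r c assume "r < dim_row (P * D)" "c < dim_col (P * D)"
    then have rc: "r < n" "c < n" using carrier by auto
    have r: "vs ! r \<in> pverts G" using rc vs n_def nth_mem by metis
    have "(A * P) $$ (r, c) =
        (\<Sum>k = 0..<n. of_bool ((vs ! r, vs ! k) \<in> parcs G) * E c (vs ! k))"
      using rc by (simp add: A_def P_def adjacency_mat_def scalar_prod_def vs(3) n_def of_bool_def)
    also have "\<dots> = (\<Sum>y\<in>pverts G. of_bool ((vs ! r, y) \<in> parcs G) * E c y)"
      by (rule sum_vs)
    also have "\<dots> = evs ! c * E c (vs ! r)"
      using rc r by (intro eigen) (auto simp: n_def)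
    also have "\<dots> = (P * D) $$ (r, c)"
      using rc by (simp add: P_def D_def scalar_prod_def if_distrib sum.delta cong: if_cong)
    finally show "(A * P) $$ (r, c) = (P * D) $$ (r, c)" .
  qed (use carrier in auto)
  then have "A = P * D * Q"
    using carrier PQ by (metis assoc_mult_mat right_mult_one_mat)
  then have "similar_mat A D"
    using carrier PQ QP by (intro similar_matI[of _ _ P Q n]) auto
  then have "char_poly A = char_poly D" by (rule char_poly_similar)
  also have "\<dots> = (\<Prod>a\<leftarrow>diag_mat D. [:- a, 1:])"
    using carrier by (intro char_poly_upper_triangular[of _ n]) (auto simp: D_def)
  also have "diag_mat D = evs"
    by (rule nth_equalityI) (simp_all add: diag_mat_def D_def n_def)
  finally show ?thesis by (simp add: A_def)
qed

text \<open>An entry lists the values at the vertices \<open>0, \<dots>, 6\<close>.  A function with value \<open>t\<close> at the centre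
  and \<open>1\<close> elsewhere is an eigenvector for \<open>\<lambda>\<close> iff \<open>\<lambda>t = 6\<close> and \<open>\<lambda> = t + 1\<close>, which gives \<open>\<lambda> = 3\<close> with
  \<open>t = 2\<close> and \<open>\<lambda> = -2\<close> with \<open>t = -3\<close>.  A function vanishing at the centre, constant on each of the
  three outer edges and with total sum zero has eigenvalue \<open>1\<close>; one that is antisymmetric on an
  outer edge and zero elsewhere has eigenvalue \<open>-1\<close>.\<close>

definition friendship_eigenvectors :: "real list list" where
  "friendship_eigenvectors =
    [[2, 1, 1, 1, 1, 1, 1], [- 3, 1, 1, 1, 1, 1, 1],
     [0, 1, 1, - 1, - 1, 0, 0], [0, 1, 1, 1, 1, - 2, - 2],
     [0, 1, - 1, 0, 0, 0, 0], [0, 0, 0, 1, - 1, 0, 0], [0, 0, 0, 0, 0, 1, - 1]]"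

lemma char_poly_friendship_graph_3:
  assumes "distinct vs" "set vs = pverts (friendship_graph 3)"
  shows "char_poly (adjacency_mat (friendship_graph 3) vs) =
    [:-3, 1:] * [:2, 1:] * [:-1, 1:] ^ 2 * [:1, 1:] ^ 3"
proof -
  let ?evs = "[3, - 2, 1, 1, - 1, - 1, - 1] :: real list"
  have verts: "pverts (friendship_graph 3) = {0, 1, 2, 3, 4, 5, 6}"
    by (auto simp: friendship_graph_def)
  have less7: "c < length ?evs \<longleftrightarrow> c \<in> {0, 1, 2, 3, 4, 5, 6}" for c by auto
  have "length vs = card (pverts (friendship_graph 3))"
    using assms by (metis distinct_card)
  then have len: "length vs = length ?evs" by (simp add: verts)
  have "char_poly (adjacency_mat (friendship_graph 3) vs) = (\<Prod>a\<leftarrow>?evs. [:- a, 1:])"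
  proof (rule char_poly_adjacency_mat_orthogonal_eigenvectors
      [where E = "\<lambda>c x. friendship_eigenvectors ! c ! x"])
    fix c x assume c: "c < length ?evs" and x: "x \<in> pverts (friendship_graph 3)"
    from x c show "(\<Sum>y\<in>pverts (friendship_graph 3). of_bool ((x, y) \<in> parcs (friendship_graph 3)) *
        friendship_eigenvectors ! c ! y) = ?evs ! c * friendship_eigenvectors ! c ! x"
      unfolding less7 verts friendship_graph_3_arc_iff insert_iff empty_iff simp_thms
      by (elim disjE) (simp_all add: friendship_eigenvectors_def)
  next
    fix c c' assume "c < length ?evs" "c' < length ?evs" "c \<noteq> c'"
    then show "(\<Sum>x\<in>pverts (friendship_graph 3).
        friendship_eigenvectors ! c ! x * friendship_eigenvectors ! c' ! x) = 0"
      unfolding less7 verts insert_iff empty_iff simp_thms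
      by (elim disjE) (simp_all add: friendship_eigenvectors_def)
  next
    fix c assume "c < length ?evs"
    then show "(\<Sum>x\<in>pverts (friendship_graph 3).
        friendship_eigenvectors ! c ! x * friendship_eigenvectors ! c ! x) \<noteq> 0"
      unfolding less7 verts insert_iff empty_iff simp_thms
      by (elim disjE) (simp_all add: friendship_eigenvectors_def)
  qed (use assms len in auto)
  then show ?thesis
    by (simp only: list.map prod_list.Cons prod_list.Nil power2_eq_square power3_eq_cube
        mult.assoc mult_1_right minus_minus)
qed

lemma adjacency_mat_map:
  assumes "\<And>x y. x \<in> set vs \<Longrightarrow> y \<in> set vs \<Longrightarrow> (x, y) \<in> parcs G \<longleftrightarrow> (f x, f y) \<in> parcs H"
  shows "adjacency_mat G vs = adjacency_mat H (map f vs)"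
  by (rule eq_matI) (auto simp: adjacency_mat_def assms)

theorem theorem5p1:
  fixes L :: "int quat ring" and u v :: "int quat" and G :: "int quat pair_pre_digraph"
  assumes L: "L = lipschitz_ring 2"
    and u: "u = \<one>\<^bsub>L\<^esub> \<oplus>\<^bsub>L\<^esub> quat_i (residue_ring 2)"
    and v: "v = \<one>\<^bsub>L\<^esub> \<oplus>\<^bsub>L\<^esub> quat_j (residue_ring 2)"
    and G: "G = zero_divisor_graph L"
  shows "(\<exists>\<phi> \<in> ring_iso L (F2_uv Quot ideal_u2_v2).
            \<phi> u = ideal_u2_v2 +>\<^bsub>F2_uv\<^esub> var_u \<and> \<phi> v = ideal_u2_v2 +>\<^bsub>F2_uv\<^esub> var_v)
       \<and> digraph_iso (with_proj G) (with_proj (friendship_graph 3))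
       \<and> (\<forall>vs. distinct vs \<and> set vs = pverts G \<longrightarrow>
            char_poly (adjacency_mat G vs) =
              [:-3, 1:] * [:2, 1:] * [:-1, 1:] ^ 2 * [:1, 1:] ^ 3)"
proof (intro conjI allI impI)
  have "quat_poly u = var_u" "quat_poly v = var_v"
    using double_F2_poly2[of 1]
    by (simp_all add: L u v quat_i_def quat_j_def residue_2_simps lipschitz_2_simps flip: add.assoc)
  then show "\<exists>\<phi> \<in> ring_iso L (F2_uv Quot ideal_u2_v2).
      \<phi> u = ideal_u2_v2 +>\<^bsub>F2_uv\<^esub> var_u \<and> \<phi> v = ideal_u2_v2 +>\<^bsub>F2_uv\<^esub> var_v"
    using quat_poly_coset_ring_iso unfolding L
    by (intro bexI[of _ "\<lambda>x. ideal_u2_v2 +>\<^bsub>F2_uv\<^esub> quat_poly x"]) simp_all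
  show "digraph_iso (with_proj G) (with_proj (friendship_graph 3))"
  proof (rule digraph_iso_with_projI)
    show "pair_wf_digraph G"
      by unfold_locales (auto simp: G zero_divisor_graph_def)
    show "pair_wf_digraph (friendship_graph 3)"
      by unfold_locales (auto simp: friendship_graph_def)
  qed (simp_all add: G L bij_betw_triangle_label triangle_label_arc_iff)
  fix vs assume vs: "distinct vs \<and> set vs = pverts G"
  then have "adjacency_mat G vs = adjacency_mat (friendship_graph 3) (map triangle_label vs)"
    by (intro adjacency_mat_map) (simp add: G L triangle_label_arc_iff)
  moreover have "distinct (map triangle_label vs)"
    "set (map triangle_label vs) = pverts (friendship_graph 3)"
    using vs bij_betw_triangle_label by (simp_all add: distinct_map G L bij_betw_def)
  ultimately show "char_poly (adjacency_mat G vs) =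
      [:-3, 1:] * [:2, 1:] * [:-1, 1:] ^ 2 * [:1, 1:] ^ 3"
    using char_poly_friendship_graph_3 by simp
qed

end
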